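(* Let $\bm{X}\in\mathbb{R}^{d\times n}$ and let $K$ be an integer with $1\le K\le\min\{n,d\}$. Define $\ell:\mathbb{R}^{d\times K}\to(-\infty,+\infty]$ by $\ell(\bm{Q})=-\|\bm{X}^T\bm{Q}\|_1+\delta_{{\rm St}(d,K)}(\bm{Q})$ and $h:\mathbb{R}^{n\times K}\times\mathbb{R}^{d\times K}\to(-\infty,+\infty]$ by $h(\bm{P},\bm{Q})=-\langle\bm{P},\bm{X}^T\bm{Q}\rangle+\delta_{\mathcal{B}(n,K)}(\bm{P})+\delta_{{\rm St}(d,K)}(\bm{Q})$. (i) Let $\bm{Q}^*\in{\rm St}(d,K)$ be a limiting critical point of $\ell$. Then there exist $\epsilon_\ell\in(0,1)$ and $\eta_\ell>0$ such that for all $\bm{Q}\in{\rm St}(d,K)$ with $\|\bm{Q}-\bm{Q}^*\|_F\le\epsilon_\ell$, $$\operatorname{dist}(\bm{0},\partial\ell(\bm{Q}))\ge\eta_\ell\,|\ell(\bm{Q})-\ell(\bm{Q}^* )|^{1/2}.$$ (ii) Let $\bm{Z}^*\in\mathcal{B}(n,K)\times{\rm St}(d,K)$ be a limiting critical point of $h$. Then there exist $\epsilon_h\in(0,1)$ and $\eta_h>0$ such that for all $\bm{Z}\in\mathcal{B}(n,K)\times{\rm St}(d,K)$ with $\|\bm{Z}-\bm{Z}^*\|_F\le\epsilon_h$, $$\operatorname{dist}(\bm{0},\partial h(\bm{Z}))\ge\eta_h\,|h(\bm{Z})-h(\bm{Z}^* )|^{1/2}.$$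
   Context: ${\rm St}(d,K)=\{\bm{Q}\in\mathbb{R}^{d\times K}:\bm{Q}^T\bm{Q}=\bm{I}_K\}$. $\mathcal{B}(n,K)$ is the set of $n\times K$ matrices with all entries in $\{-1,+1\}$. $\|\bm{A}\|_1=\sum_{i,j}|A_{ij}|$, $\langle\bm{A},\bm{B}\rangle=\operatorname{tr}(\bm{A}^T\bm{B})$, and $\|\cdot\|_F$ is the Frobenius norm (for a pair $\bm{Z}=(\bm{P},\bm{Q})$, $\|\bm{Z}\|_F^2=\|\bm{P}\|_F^2+\|\bm{Q}\|_F^2$). $\delta_{\mathcal{S}}$ is the indicator function of a closed set $\mathcal{S}$ (0 on $\mathcal{S}$, $+\infty$ off it). $\partial f$ denotes the limiting subdifferential of a proper lower semicontinuous function $f$ (the limit of Fréchet subgradients $\bm{v}^k\in\widehat\partial f(\bm{x}^k)$ along $\bm{x}^k\to\bm{x}$ with $f(\bm{x}^k)\to f(\bm{x})$, where $\bm{v}\in\widehat\partial f(\bm{x})$ iff $\liminf_{\bm{y}\to\bm{x},\bm{y}\ne\bm{x}}\frac{f(\bm{y})-f(\bm{x})-\langle\bm{v},\bm{y}-\bm{x}\rangle}{\|\bm{y}-\bm{x}\|_F}\ge0$); $\partial f(\bm{x})=\emptyset$ if $f(\bm{x})=+\infty$. A limiting critical point of $f$ is a point $\bm{x}$ with $\bm{0}\in\partial f(\bm{x})$. $\operatorname{dist}(\bm{0},S)=\inf_{\bm{s}\in S}\|\bm{s}\|_F$. *)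

theory Defs
  imports "HOL-Analysis.Analysis"
begin

text \<open>Matrices in R^{m x p} are rendered as real^'p^'m (rows indexed by 'm).
  The Euclidean norm on this type is the Frobenius norm; on pairs it is
  sqrt(norm P^2 + norm Q^2), as in the paper.\<close>

definition stiefel :: "(real^'k^'d) set" where
  "stiefel = {Q. transpose Q ** Q = mat 1}"

definition binmats :: "(real^'k^'n) set" where
  "binmats = {P. \<forall>i j. P $ i $ j = -1 \<or> P $ i $ j = 1}"

definition l1norm :: "real^'k^'n \<Rightarrow> real" where
  "l1norm A = (\<Sum>i\<in>UNIV. \<Sum>j\<in>UNIV. \<bar>A $ i $ j\<bar>)"

definition frob_inner :: "real^'k^'n \<Rightarrow> real^'k^'n \<Rightarrow> real" where
  "frob_inner A B = trace (transpose A ** B)"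

definition indic :: "'a set \<Rightarrow> 'a \<Rightarrow> ereal" where
  "indic S x = (if x \<in> S then 0 else \<infinity>)"

definition frechet_subdiff :: "('a::euclidean_space \<Rightarrow> ereal) \<Rightarrow> 'a \<Rightarrow> 'a set" where
  "frechet_subdiff f x = {v. \<bar>f x\<bar> \<noteq> \<infinity> \<and>
     Liminf (at x) (\<lambda>y. (f y - f x - ereal (inner v (y - x))) / ereal (norm (y - x))) \<ge> 0}"

definition limiting_subdiff :: "('a::euclidean_space \<Rightarrow> ereal) \<Rightarrow> 'a \<Rightarrow> 'a set" where
  "limiting_subdiff f x = {v. \<bar>f x\<bar> \<noteq> \<infinity> \<and>
     (\<exists>xs vs. xs \<longlonglongrightarrow> x \<and> (\<lambda>k. f (xs k)) \<longlonglongrightarrow> f x \<and>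
              vs \<longlonglongrightarrow> v \<and> (\<forall>k. vs k \<in> frechet_subdiff f (xs k)))}"

definition limiting_critical :: "('a::euclidean_space \<Rightarrow> ereal) \<Rightarrow> 'a \<Rightarrow> bool" where
  "limiting_critical f x \<longleftrightarrow> 0 \<in> limiting_subdiff f x"

text \<open>dist(0,S) = inf over S of norms, with inf of the empty set = +infinity.\<close>
definition dist0 :: "'a::real_normed_vector set \<Rightarrow> ereal" where
  "dist0 S = (INF s\<in>S. ereal (norm s))"

definition ell_fun :: "real^'n^'d \<Rightarrow> real^'k^'d \<Rightarrow> ereal" where
  "ell_fun X Q = ereal (- l1norm (transpose X ** Q)) + indic stiefel Q"

definition h_fun :: "real^'n^'d \<Rightarrow> ((real^'k^'n) \<times> (real^'k^'d)) \<Rightarrow> ereal" where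
  "h_fun X Z = ereal (- frob_inner (fst Z) (transpose X ** snd Z))
      + indic binmats (fst Z) + indic stiefel (snd Z)"

end

theory Submission
  imports Defs
begin

text \<open>
  Rotating two rows of a point $Q$ of the Stiefel manifold shows that a subgradient $v$ of
  $-\langle M, \cdot\rangle$ restricted to the manifold makes $(v + M)Q^T$ symmetric. Put
  $W = MQ^T$. Then $WW^T = MM^T$ does not depend on $Q$, $\langle M, Q\rangle$ is the trace of
  $W$, and $\|W - W^T\|$ is at most a constant times $\|v\|$. For each eigenvalue $\lambda$ of
  $(W + W^T)/2$, a quadratic eigenvalue estimate for $MM^T$ puts $\lambda$ within
  $O(\|W - W^T\|^2)$ of some $\pm\sigma$ with $\sigma^2$ an eigenvalue of $MM^T$. Summing over
  $\lambda$, the value $\langle M, Q\rangle$ is within $O(\|v\|^2)$ of a finite set depending only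
  on $M$. By continuity this forces the inequality with exponent 1/2 around every point, critical
  or not. Both $h$ and $\ell$ reduce to finitely many $M = XP$ with $P$ a sign matrix, since
  $\ell$ is the minimum of $h$ over $P$.
\<close>

section \<open>Eigenbases of self-adjoint maps\<close>

text \<open>For small \<open>t\<close> of sign opposite to \<open>a\<close> the linear term
  dominates and makes the value negative. This serves as the first-order condition at a
  maximum.\<close>

lemma quadratic_nonneg_linear_zero:
  fixes a b :: real
  assumes "\<And>t. 0 \<le> a * t + b * t\<^sup>2"
  shows "a = 0"
proof (rule ccontr)
  assume "a \<noteq> 0"
  \<comment> \<open>This size keeps \<open>\<bar>b\<bar> * s\<close> at most half of
    \<open>\<bar>a\<bar>\<close>; the added 1 covers \<open>b = 0\<close>.\<close>
  define s where "s = \<bar>a\<bar> / (2 * (\<bar>b\<bar> + 1))"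
  have "s > 0" using \<open>a \<noteq> 0\<close> by (simp add: s_def)
  have "\<bar>b\<bar> * s < \<bar>a\<bar>"
  proof -
    have "\<bar>b\<bar> * s \<le> (\<bar>b\<bar> + 1) * s" using \<open>s > 0\<close> by (simp add: algebra_simps)
    also have "\<dots> = \<bar>a\<bar> / 2"
      unfolding s_def by (simp add: divide_simps)
    finally show ?thesis using \<open>a \<noteq> 0\<close> by linarith
  qed
  have "0 \<le> a * (- sgn a * s) + b * (- sgn a * s)\<^sup>2" by (rule assms)
  also have "\<dots> = - \<bar>a\<bar> * s + b * s * s"
    using \<open>a \<noteq> 0\<close> by (simp add: sgn_if power2_eq_square)
  also have "\<dots> \<le> s * (\<bar>b\<bar> * s - \<bar>a\<bar>)"
    using mult_right_mono[OF abs_ge_self[of b], of "s * s"] by (simp add: algebra_simps)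
  also have "\<dots> < 0" using \<open>s > 0\<close> \<open>\<bar>b\<bar> * s < \<bar>a\<bar>\<close> by (simp add: mult_pos_neg)
  finally show False by simp
qed

text \<open>The Rayleigh quotient attains its maximum on the compact unit sphere of
  \<open>V\<close>. At a maximizer \<open>u\<close> the first variation along the residual vanishes,
  and this variation is twice the squared norm of the residual.\<close>

lemma self_adjoint_has_eigenvector:
  fixes f :: "'a::euclidean_space \<Rightarrow> 'a"
  assumes "linear f" and adj: "\<And>x y. f x \<bullet> y = x \<bullet> f y"
    and V: "subspace V" "f ` V \<subseteq> V" "V \<noteq> {0}"
  obtains u l where "u \<in> V" "norm u = 1" "f u = l *\<^sub>R u"
proof -
  interpret linear f by fact
  define K where "K = sphere 0 1 \<inter> V"
  have "compact K" unfolding K_def by (intro compact_Int_closed closed_subspace V) auto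
  moreover have "K \<noteq> {}"
  proof -
    obtain v where "v \<in> V" "v \<noteq> 0" using V(1,3) subspace_0 by blast
    then have "(1 / norm v) *\<^sub>R v \<in> K"
      using V(1) by (simp add: K_def subspace_scale)
    then show ?thesis by auto
  qed
  moreover have "continuous_on K (\<lambda>x. f x \<bullet> x)"
    by (intro continuous_intros linear_continuous_on) (simp add: \<open>linear f\<close> linear_conv_bounded_linear[symmetric])
  ultimately obtain u where u: "u \<in> K" and max: "\<And>x. x \<in> K \<Longrightarrow> f x \<bullet> x \<le> f u \<bullet> u"
    using continuous_attains_sup[of K "\<lambda>x. f x \<bullet> x"] by blast
  define l where "l = f u \<bullet> u"
  have uV: "u \<in> V" and nu: "norm u = 1" using u by (auto simp: K_def)
  have le: "f x \<bullet> x \<le> l * (x \<bullet> x)" if "x \<in> V" for x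
  proof (cases "x = 0")
    case False
    then have "(1 / norm x) *\<^sub>R x \<in> K"
      using that V(1) by (simp add: K_def subspace_scale)
    from max[OF this] have "(f x \<bullet> x) / (norm x)\<^sup>2 \<le> l"
      by (simp add: l_def scale power2_eq_square field_simps)
    then show ?thesis using False by (simp add: dot_square_norm field_simps)
  qed (simp add: zero)
  define w where "w = l *\<^sub>R u - f u"
  have wV: "w \<in> V" using V uV by (auto simp: w_def intro!: subspace_diff subspace_scale)
  \<comment> \<open>The bound \<open>le\<close> is expanded at \<open>u + t *\<^sub>R w\<close>, a
    point of \<open>V\<close>. The constant term vanishes because \<open>u\<close> attains the
    maximum.\<close>
  have "0 \<le> 2 * (w \<bullet> w) * t + (l * (w \<bullet> w) - f w \<bullet> w) * t\<^sup>2" for t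
  proof -
    have "u + t *\<^sub>R w \<in> V" using V(1) uV wV by (intro subspace_add subspace_scale)
    from le[OF this] have "0 \<le> l * ((u + t *\<^sub>R w) \<bullet> (u + t *\<^sub>R w)) - (f u + t *\<^sub>R f w) \<bullet> (u + t *\<^sub>R w)"
      by (simp add: add scale)
    also have "\<dots> = l * (u \<bullet> u) - f u \<bullet> u + 2 * t * (l * (u \<bullet> w) - f u \<bullet> w)
        + (l * (w \<bullet> w) - f w \<bullet> w) * t\<^sup>2"
      using adj[of w u] by (simp add: algebra_simps inner_commute power2_eq_square)
    also have "l * (u \<bullet> w) - f u \<bullet> w = w \<bullet> w"
      by (simp add: w_def inner_diff_left)
    also have "l * (u \<bullet> u) - f u \<bullet> u = 0" using nu by (simp add: l_def dot_square_norm)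
    finally show ?thesis by (simp add: algebra_simps)
  qed
  then have "2 * (w \<bullet> w) = 0" by (rule quadratic_nonneg_linear_zero)
  then have "f u = l *\<^sub>R u" by (simp add: w_def)
  with uV nu show ?thesis by (rule that)
qed

text \<open>Induction on the dimension: an eigenvector is split off, and its orthogonal complement
  within \<open>V\<close> is again invariant because \<open>f\<close> is self-adjoint.\<close>

lemma self_adjoint_eigenbasis_subspace:
  fixes f :: "'a::euclidean_space \<Rightarrow> 'a"
  assumes lin: "linear f" and adj: "\<And>x y. f x \<bullet> y = x \<bullet> f y"
  shows "subspace V \<Longrightarrow> f ` V \<subseteq> V \<Longrightarrow>
    \<exists>B \<subseteq> V. finite B \<and> pairwise orthogonal B \<and> (\<forall>b\<in>B. norm b = 1 \<and> (\<exists>l. f b = l *\<^sub>R b)) \<and> span B = V"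
proof (induction "dim V" arbitrary: V rule: less_induct)
  case less
  show ?case
  proof (cases "V = {0}")
    case True
    then show ?thesis by (intro exI[of _ "{}"]) auto
  next
    case False
    obtain u l where u: "u \<in> V" "norm u = 1" "f u = l *\<^sub>R u"
      using self_adjoint_has_eigenvector[OF lin adj less.prems False] by blast
    define V' where "V' = {x \<in> V. u \<bullet> x = 0}"
    have sub: "subspace V'"
      using less.prems(1) by (auto simp: V'_def subspace_def inner_add_right)
    have inv: "f ` V' \<subseteq> V'"
      using less.prems(2) u(3) by (auto simp: V'_def adj[of u, symmetric])
    have "u \<notin> V'" using u(2) by (auto simp: V'_def dot_square_norm)
    moreover have "V' \<subseteq> V" by (auto simp: V'_def)
    ultimately have "V' \<subset> V" using u(1) by blast
    then have "dim V' < dim V"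
      using sub less.prems(1) by (intro dim_psubset) (simp add: span_eq_iff[THEN iffD2])
    from less.hyps[OF this sub inv] obtain B where B: "B \<subseteq> V'" "finite B" "pairwise orthogonal B"
      "\<forall>b\<in>B. norm b = 1 \<and> (\<exists>l. f b = l *\<^sub>R b)" "span B = V'" by blast
    have "span (insert u B) = V"
    proof
      show "span (insert u B) \<subseteq> V"
        using u(1) B(1) less.prems(1) \<open>V' \<subset> V\<close> by (intro span_minimal) auto
      show "V \<subseteq> span (insert u B)"
      proof
        fix x assume "x \<in> V"
        then have "x - (u \<bullet> x) *\<^sub>R u \<in> V'"
          using u less.prems(1)
          by (auto simp: V'_def dot_square_norm inner_diff_right intro!: subspace_diff subspace_scale)
        then have "x - (u \<bullet> x) *\<^sub>R u \<in> span B" using B(5) by simp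
        then show "x \<in> span (insert u B)" unfolding span_insert by blast
      qed
    qed
    moreover have "pairwise orthogonal (insert u B)"
      using B(1,3) by (auto simp: pairwise_insert V'_def orthogonal_def inner_commute)
    ultimately show ?thesis
      using B u \<open>V' \<subset> V\<close> by (intro exI[of _ "insert u B"]) auto
  qed
qed

lemma self_adjoint_eigenbasis:
  fixes f :: "'a::euclidean_space \<Rightarrow> 'a"
  assumes "linear f" "\<And>x y. f x \<bullet> y = x \<bullet> f y"
  obtains B l where "finite B" "pairwise orthogonal B" "\<And>b. b \<in> B \<Longrightarrow> norm b = 1"
    "\<And>b. b \<in> B \<Longrightarrow> f b = l b *\<^sub>R b" "span B = UNIV"
proof -
  obtain B where B: "finite B" "pairwise orthogonal B" "\<forall>b\<in>B. norm b = 1 \<and> (\<exists>l. f b = l *\<^sub>R b)" "span B = UNIV"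
    using self_adjoint_eigenbasis_subspace[OF assms, of UNIV] by auto
  from B(3) obtain l where "\<forall>b\<in>B. f b = l b *\<^sub>R b" by metis
  with B that show ?thesis by blast
qed

lemma inner_orthonormal_expand:
  fixes x :: "'a::euclidean_space"
  assumes "finite B" "pairwise orthogonal B" "\<And>b. b \<in> B \<Longrightarrow> norm b = 1" "span B = UNIV"
  shows "x \<bullet> y = (\<Sum>b\<in>B. (x \<bullet> b) * (y \<bullet> b))"
proof -
  have "x \<bullet> y = (\<Sum>b\<in>B. (x \<bullet> b) *\<^sub>R b) \<bullet> y"
    using assms by (subst orthonormal_basis_expand) auto
  then show ?thesis by (simp add: inner_sum_left inner_commute[of y])
qed

lemma norm_orthonormal_sum:
  fixes c :: "'a::euclidean_space \<Rightarrow> real"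
  assumes "finite B" "pairwise orthogonal B" "\<And>b. b \<in> B \<Longrightarrow> norm b = 1"
  shows "(norm (\<Sum>b\<in>B. c b *\<^sub>R b))\<^sup>2 = (\<Sum>b\<in>B. (c b)\<^sup>2)"
proof -
  have "(norm (\<Sum>b\<in>B. c b *\<^sub>R b))\<^sup>2 = (\<Sum>b\<in>B. (norm (c b *\<^sub>R b))\<^sup>2)"
    using assms by (intro norm_sum_Pythagorean) (auto simp: pairwise_def orthogonal_def)
  then show ?thesis using assms(3) by simp
qed

section \<open>Trace and Frobenius norm\<close>

lemma inner_matrix_vector_left: "((A::real^'n^'m) *v x) \<bullet> y = x \<bullet> (transpose A *v y)"
  by (metis dot_lmul_matrix inner_commute transpose_matrix_vector)

text \<open>The trace does not depend on the orthonormal basis: its diagonal entries are expanded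
  along \<open>B\<close> and the two sums are swapped.\<close>

lemma trace_eq_sum_inner_orthonormal:
  fixes W :: "real^'n^'n"
  assumes "finite B" "pairwise orthogonal B" "\<And>b. b \<in> B \<Longrightarrow> norm b = 1" "span B = UNIV"
  shows "trace W = (\<Sum>b\<in>B. b \<bullet> (W *v b))"
proof -
  have "trace W = (\<Sum>i\<in>UNIV. (W *v axis i 1) \<bullet> axis i 1)"
    by (simp add: trace_def inner_axis matrix_vector_mul_component)
  also have "\<dots> = (\<Sum>i\<in>UNIV. \<Sum>b\<in>B. ((W *v axis i 1) \<bullet> b) * (axis i 1 \<bullet> b))"
    by (subst inner_orthonormal_expand[OF assms]) auto
  also have "\<dots> = (\<Sum>b\<in>B. \<Sum>i\<in>UNIV. (transpose W *v b) $ i * b $ i)"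
    by (subst sum.swap) (simp add: inner_matrix_vector_left inner_axis' del: transpose_matrix_vector)
  also have "\<dots> = (\<Sum>b\<in>B. (transpose W *v b) \<bullet> b)"
    by (simp add: inner_vec_def)
  also have "\<dots> = (\<Sum>b\<in>B. b \<bullet> (W *v b))"
    by (metis (no_types) inner_matrix_vector_left transpose_transpose)
  finally show ?thesis .
qed

lemma norm_vec_square: "(norm (x::('a::real_inner)^'n))\<^sup>2 = (\<Sum>i\<in>UNIV. (norm (x $ i))\<^sup>2)"
  by (simp add: power2_norm_eq_inner inner_vec_def)

lemma norm_transpose: "norm (transpose (A::real^'n^'m)) = norm A"
proof -
  have "(norm (transpose A))\<^sup>2 = (norm A)\<^sup>2"
    by (simp only: norm_vec_square transpose_def vec_lambda_beta real_norm_def) (rule sum.swap)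
  then show ?thesis by simp
qed

lemma norm_matrix_vector_le: "norm ((A::real^'n^'m) *v x) \<le> norm A * norm x"
proof (rule power2_le_imp_le)
  have "(norm (A *v x))\<^sup>2 = (\<Sum>i\<in>UNIV. \<bar>A $ i \<bullet> x\<bar>\<^sup>2)"
    by (simp add: norm_vec_square matrix_vector_mul_component)
  also have "\<dots> \<le> (\<Sum>i\<in>UNIV. (norm (A $ i) * norm x)\<^sup>2)"
    by (intro sum_mono power_mono Cauchy_Schwarz_ineq2) auto
  also have "\<dots> = (norm A * norm x)\<^sup>2"
    by (simp add: norm_vec_square power_mult_distrib sum_distrib_right)
  finally show "(norm (A *v x))\<^sup>2 \<le> (norm A * norm x)\<^sup>2" .
qed simp

text \<open>Each row of \<open>A ** B\<close> is the image of the corresponding row of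
  \<open>A\<close> under the transpose of \<open>B\<close>, so the bound for vectors applies row by
  row.\<close>

lemma norm_matrix_mul_le: "norm ((A::real^'n^'m) ** (B::real^'p^'n)) \<le> norm A * norm B"
proof (rule power2_le_imp_le)
  have "(A ** B) $ i = transpose B *v (A $ i)" for i
    by (simp add: vec_eq_iff matrix_matrix_mult_def vector_matrix_mult_def mult.commute)
  then have "(norm (A ** B))\<^sup>2 = (\<Sum>i\<in>UNIV. (norm (transpose B *v (A $ i)))\<^sup>2)"
    by (simp add: norm_vec_square[of "A ** B"] del: transpose_matrix_vector)
  also have "\<dots> \<le> (\<Sum>i\<in>UNIV. (norm B * norm (A $ i))\<^sup>2)"
    by (intro sum_mono power_mono order_trans[OF norm_matrix_vector_le])
      (auto simp: norm_transpose)
  also have "\<dots> = (norm A * norm B)\<^sup>2"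
    by (simp add: norm_vec_square[of A] power_mult_distrib sum_distrib_left mult.commute)
  finally show "(norm (A ** B))\<^sup>2 \<le> (norm A * norm B)\<^sup>2" .
qed simp

lemma inner_matrix_trace: "(A::real^'n^'m) \<bullet> B = trace (A ** transpose B)"
  by (simp add: inner_vec_def trace_def matrix_matrix_mult_def transpose_def)

section \<open>Quadratic eigenvalue estimates\<close>

text \<open>The coordinates of $u$ along eigenvectors for the other eigenvalues are bounded by the residual,
  and the error of the Rayleigh quotient is a combination of their squares.\<close>

lemma nearest_eigenvalue:
  fixes u :: "'a::euclidean_space"
  assumes B: "finite B" "pairwise orthogonal B" "\<And>b. b \<in> B \<Longrightarrow> norm b = 1" "span B = UNIV"
    and Cu: "\<And>b. b \<in> B \<Longrightarrow> Cu \<bullet> b = g b * (u \<bullet> b)"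
    and u: "norm u = 1"
    and gap: "0 < \<delta>" "\<And>b b'. b \<in> B \<Longrightarrow> b' \<in> B \<Longrightarrow> g b \<noteq> g b' \<Longrightarrow> \<delta> \<le> \<bar>g b - g b'\<bar>"
  obtains e where "e \<in> B" "\<bar>u \<bullet> Cu - g e\<bar> \<le> 4 / \<delta> * (norm (Cu - \<mu> *\<^sub>R u))\<^sup>2"
    "norm (\<Sum>b | b \<in> B \<and> g b \<noteq> g e. (u \<bullet> b) *\<^sub>R b) \<le> 2 / \<delta> * norm (Cu - \<mu> *\<^sub>R u)"
proof -
  define r where "r = Cu - \<mu> *\<^sub>R u"
  have "B \<noteq> {}"
  proof
    assume "B = {}"
    with B(4) have "u \<in> {0}" by (metis UNIV_I span_empty)
    with u show False by simp
  qed
  then obtain e where e: "e \<in> B" and min: "\<And>b. b \<in> B \<Longrightarrow> \<bar>g e - \<mu>\<bar> \<le> \<bar>g b - \<mu>\<bar>"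
    using ex_is_arg_min_if_finite[of B "\<lambda>b. \<bar>g b - \<mu>\<bar>"] B(1)
    by (fastforce simp: is_arg_min_linorder)
  have rb: "r \<bullet> b = (g b - \<mu>) * (u \<bullet> b)" if "b \<in> B" for b
    using Cu[OF that] by (simp add: r_def inner_diff_left algebra_simps)
  \<comment> \<open>Since \<open>g e\<close> is the value nearest to \<open>\<mu>\<close>, the
    triangle inequality bounds \<open>\<bar>g b - g e\<bar>\<close> by twice the distance from
    \<open>g b\<close> to \<open>\<mu>\<close>; the gap then keeps \<open>g b\<close> at least
    \<open>\<delta> / 2\<close> away from \<open>\<mu>\<close>.\<close>
  have far: "\<delta> / 2 \<le> \<bar>g b - \<mu>\<bar>" "\<bar>g b - g e\<bar> \<le> 2 * \<bar>g b - \<mu>\<bar>" if "b \<in> B" "g b \<noteq> g e" for b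
    using gap(2)[OF that(1) e that(2)] min[OF that(1)] by (smt (verit) field_sum_of_halves)+
  have norm_r: "(norm r)\<^sup>2 = (\<Sum>b\<in>B. (r \<bullet> b)\<^sup>2)"
    unfolding power2_norm_eq_inner by (subst inner_orthonormal_expand[OF B]) (auto simp: power2_eq_square)
  have sum_u: "(\<Sum>b\<in>B. (u \<bullet> b)\<^sup>2) = 1"
    using inner_orthonormal_expand[OF B, of u u] u by (simp add: power2_eq_square dot_square_norm)
  \<comment> \<open>The squared coordinates of \<open>u\<close> sum to 1, so the error is the
    weighted mean of the differences \<open>g b - g e\<close>.\<close>
  have "u \<bullet> Cu - g e = (\<Sum>b\<in>B. (u \<bullet> b) * (Cu \<bullet> b)) - g e * (\<Sum>b\<in>B. (u \<bullet> b)\<^sup>2)"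
    using inner_orthonormal_expand[OF B, of u Cu] sum_u by simp
  also have "\<dots> = (\<Sum>b\<in>B. (g b - g e) * (u \<bullet> b)\<^sup>2)"
    unfolding sum_distrib_left sum_subtractf[symmetric]
    by (intro sum.cong) (auto simp: Cu power2_eq_square algebra_simps)
  finally have "\<bar>u \<bullet> Cu - g e\<bar> \<le> (\<Sum>b\<in>B. \<bar>(g b - g e) * (u \<bullet> b)\<^sup>2\<bar>)"
    by (metis sum_abs)
  also have "\<dots> \<le> (\<Sum>b\<in>B. 4 / \<delta> * (r \<bullet> b)\<^sup>2)"
  proof (rule sum_mono)
    fix b assume b: "b \<in> B"
    show "\<bar>(g b - g e) * (u \<bullet> b)\<^sup>2\<bar> \<le> 4 / \<delta> * (r \<bullet> b)\<^sup>2"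
    proof (cases "g b = g e")
      case False
      let ?h = "\<bar>g b - \<mu>\<bar>"
      \<comment> \<open>Both \<open>\<delta>\<close> and \<open>\<bar>g b - g e\<bar>\<close> are at
        most \<open>2 * ?h\<close>. Multiplying the two bounds produces the square that the residual
        coordinate supplies.\<close>
      have "\<delta> * \<bar>g b - g e\<bar> \<le> (2 * ?h) * (2 * ?h)"
        using far[OF b False] gap(1) by (intro mult_mono) auto
      then have "\<bar>g b - g e\<bar> \<le> 4 / \<delta> * (g b - \<mu>)\<^sup>2"
        using gap(1) by (simp add: field_simps power2_eq_square)
      then have "\<bar>g b - g e\<bar> * (u \<bullet> b)\<^sup>2 \<le> 4 / \<delta> * (g b - \<mu>)\<^sup>2 * (u \<bullet> b)\<^sup>2"
        by (rule mult_right_mono) simp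
      then show ?thesis by (simp add: rb[OF b] power_mult_distrib abs_mult mult.assoc)
    qed (use gap(1) in simp)
  qed
  also have "\<dots> = 4 / \<delta> * (norm r)\<^sup>2" by (simp add: norm_r sum_distrib_left)
  finally have 1: "\<bar>u \<bullet> Cu - g e\<bar> \<le> 4 / \<delta> * (norm r)\<^sup>2" .
  have "norm (\<Sum>b | b \<in> B \<and> g b \<noteq> g e. (u \<bullet> b) *\<^sub>R b) \<le> 2 / \<delta> * norm r"
  proof (rule power2_le_imp_le)
    have "(norm (\<Sum>b | b \<in> B \<and> g b \<noteq> g e. (u \<bullet> b) *\<^sub>R b))\<^sup>2 = (\<Sum>b | b \<in> B \<and> g b \<noteq> g e. (u \<bullet> b)\<^sup>2)"
      using B by (intro norm_orthonormal_sum) (auto intro: pairwise_mono)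
    also have "\<dots> \<le> (\<Sum>b | b \<in> B \<and> g b \<noteq> g e. (2 / \<delta> * (r \<bullet> b))\<^sup>2)"
    proof (rule sum_mono)
      fix b assume "b \<in> {b. b \<in> B \<and> g b \<noteq> g e}"
      then have b: "b \<in> B" "g b \<noteq> g e" by auto
      have "1 \<le> 2 / \<delta> * \<bar>g b - \<mu>\<bar>" using far(1)[OF b] gap(1) by (simp add: field_simps)
      then have "1 * \<bar>u \<bullet> b\<bar> \<le> 2 / \<delta> * \<bar>g b - \<mu>\<bar> * \<bar>u \<bullet> b\<bar>"
        by (intro mult_right_mono) auto
      also have "\<dots> = \<bar>2 / \<delta> * (r \<bullet> b)\<bar>"
        using gap(1) by (simp add: rb[OF b(1)] abs_mult)
      finally show "(u \<bullet> b)\<^sup>2 \<le> (2 / \<delta> * (r \<bullet> b))\<^sup>2"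
        by (simp only: abs_le_square_iff mult_1)
    qed
    also have "\<dots> \<le> (\<Sum>b\<in>B. (2 / \<delta> * (r \<bullet> b))\<^sup>2)"
      using B(1) by (intro sum_mono2) auto
    also have "\<dots> = (2 / \<delta> * norm r)\<^sup>2"
      unfolding power_mult_distrib norm_r sum_distrib_left ..
    finally show "(norm (\<Sum>b | b \<in> B \<and> g b \<noteq> g e. (u \<bullet> b) *\<^sub>R b))\<^sup>2 \<le> (2 / \<delta> * norm r)\<^sup>2" .
  qed (use gap(1) in simp)
  with 1 e that show ?thesis unfolding r_def by blast
qed

lemma norm_square_eq_trace: "(norm (W::real^'n^'m))\<^sup>2 = trace (W ** transpose W)"
  by (simp add: power2_norm_eq_inner inner_matrix_trace)

text \<open>With \<open>k\<close> the norm of \<open>W - transpose W\<close>, write W u = l u + p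
  and W^T u = l u - p, where p is orthogonal to u and of size O(k). Then u is an approximate
  eigenvector of C = W W^T for l^2 with residual O(k), and its Rayleigh quotient is l^2 + |p|^2.
  Hence l^2 is within O(k^2) of an eigenvalue of C. It remains to pass to square roots, which needs
  a separate argument at the eigenvalue 0.\<close>

lemma symmetric_part_eigenvalue_near:
  fixes C :: "real^'n^'n"
  shows "\<exists>c T. finite T \<and> (\<forall>W u l. W ** transpose W = C \<longrightarrow> norm u = 1 \<longrightarrow>
    W *v u + transpose W *v u = (2 * l) *\<^sub>R u \<longrightarrow> (\<exists>t\<in>T. \<bar>l - t\<bar> \<le> c * (norm (W - transpose W))\<^sup>2))"
\<comment> \<open>Without such a factorization the claim is vacuous. With one, \<open>C\<close> is
  symmetric and has an orthonormal eigenbasis.\<close>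
proof (cases "\<exists>W::real^'n^'n. W ** transpose W = C")
  case True
  then have "transpose C = C" by (metis matrix_transpose_mul transpose_transpose)
  then have "(C *v x) \<bullet> y = x \<bullet> (C *v y)" for x y by (metis inner_matrix_vector_left)
  then obtain B g where B: "finite B" "pairwise orthogonal B" "\<And>b. b \<in> B \<Longrightarrow> norm b = 1" "span B = UNIV"
    and g: "\<And>b. b \<in> B \<Longrightarrow> C *v b = g b *\<^sub>R b"
    using self_adjoint_eigenbasis[of "(*v) C"] by (metis matrix_vector_mul_linear)
  have "\<exists>\<delta>>0. \<forall>b\<in>B. \<forall>b'\<in>B. g b \<noteq> g b' \<longrightarrow> \<delta> \<le> \<bar>g b - g b'\<bar>"
  proof -
    obtain \<delta> where "\<delta> > 0" "\<forall>x\<in>(\<lambda>(b,b'). g b - g b') ` (B \<times> B). x \<noteq> 0 \<longrightarrow> \<delta> \<le> dist 0 x"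
      using finite_set_avoid[of "(\<lambda>(b,b'). g b - g b') ` (B \<times> B)" 0] B(1) by blast
    then show ?thesis by (intro exI[of _ \<delta>]) auto
  qed
  then obtain \<delta> where \<delta>: "\<delta> > 0" "\<And>b b'. b \<in> B \<Longrightarrow> b' \<in> B \<Longrightarrow> g b \<noteq> g b' \<Longrightarrow> \<delta> \<le> \<bar>g b - g b'\<bar>"
    by blast
  \<comment> \<open>While \<open>\<delta>\<close> separates distinct eigenvalues of
    \<open>C\<close>, \<open>m\<close> bounds the nonzero square roots of eigenvalues away from
    0.\<close>
  obtain m where m: "m > 0" "\<And>b. b \<in> B \<Longrightarrow> sqrt (g b) \<noteq> 0 \<Longrightarrow> m \<le> \<bar>sqrt (g b)\<bar>"
    using finite_set_avoid[of "(\<lambda>b. sqrt (g b)) ` B" 0] B(1) by (auto simp: dist_real_def)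
  define T where "T = (\<lambda>b. sqrt (g b)) ` B \<union> (\<lambda>b. - sqrt (g b)) ` B"
  \<comment> \<open>This is the common Frobenius norm of all \<open>W\<close> with
    \<open>W ** transpose W = C\<close>, so the constants below depend on \<open>C\<close> alone. In
    terms of \<open>k\<close>, the norm of \<open>W - transpose W\<close>, \<open>c1\<close> is the
    factor in the k^2 bound for l^2, and \<open>c2 * k\<close> bounds the part of \<open>u\<close>
    outside the kernel of \<open>C\<close>.\<close>
  define w where "w = sqrt (trace C)"
  define c1 where "c1 = 4 / \<delta> * (2 * w)\<^sup>2 + 1"
  define c2 where "c2 = 2 / \<delta> * (2 * w)"
  define c where "c = max (c1 / m) (c2 + w * c2\<^sup>2)"
  have "\<exists>t\<in>T. \<bar>l - t\<bar> \<le> c * (norm (W - transpose W))\<^sup>2"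
    if WC: "W ** transpose W = C" and u: "norm u = 1" and eig: "W *v u + transpose W *v u = (2 * l) *\<^sub>R u"
    for W u l
  proof -
    define k where "k = norm (W - transpose W)"
    have k0: "k \<ge> 0" by (simp add: k_def)
    have nW: "norm W = w" using norm_square_eq_trace[of W] WC by (simp add: w_def real_sqrt_unique)
    then have w0: "w \<ge> 0" by (metis norm_ge_zero)
    define p where "p = W *v u - l *\<^sub>R u"
    have Wu: "W *v u = l *\<^sub>R u + p" by (simp add: p_def)
    have Wtu: "transpose W *v u = l *\<^sub>R u - p"
    proof -
      have "transpose W *v u = (2 * l) *\<^sub>R u - W *v u" using eig by (metis add_diff_cancel_left')
      also have "\<dots> = l *\<^sub>R u - p" by (simp add: p_def scaleR_left.add[symmetric] algebra_simps flip: scaleR_left_distrib)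
      finally show ?thesis .
    qed
    have "2 *\<^sub>R p = (W - transpose W) *v u"
      by (simp only: matrix_vector_mult_diff_rdistrib Wu Wtu) (simp add: scaleR_2)
    then have "2 * norm p = norm ((W - transpose W) *v u)" by (metis norm_scaleR abs_numeral)
    then have np: "norm p \<le> k" 
      using norm_matrix_vector_le[of "W - transpose W" u] u k0 unfolding k_def by (smt (verit) mult_cancel_left2)
    \<comment> \<open>The quadratic forms of \<open>W\<close> and its transpose agree at
      \<open>u\<close>, which forces the first-order cross term to vanish.\<close>
    have up: "u \<bullet> p = 0"
    proof -
      have "(W *v u) \<bullet> u = u \<bullet> (transpose W *v u)" by (rule inner_matrix_vector_left)
      then show ?thesis unfolding Wu Wtu by (simp add: inner_simps inner_commute)
    qed
    have l: "\<bar>l\<bar> \<le> w"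
    proof -
      have "l = u \<bullet> (W *v u)" using u up by (simp add: Wu inner_simps dot_square_norm)
      also have "\<bar>\<dots>\<bar> \<le> norm u * (norm W * norm u)"
        by (rule order_trans[OF Cauchy_Schwarz_ineq2]) (intro mult_left_mono norm_matrix_vector_le, simp)
      finally show ?thesis using u nW by simp
    qed
    define r where "r = C *v u - (l\<^sup>2) *\<^sub>R u"
    have "C *v u = W *v (transpose W *v u)" using WC by (simp add: matrix_vector_mul_assoc del: transpose_matrix_vector)
    also have "\<dots> = l *\<^sub>R (W *v u) - W *v p"
      unfolding Wtu by (simp add: matrix_vector_mult_diff_distrib matrix_vector_mult_scaleR)
    finally have Cu: "C *v u = l *\<^sub>R (W *v u) - W *v p" .
    then have "r = l *\<^sub>R p - W *v p" by (simp add: r_def Wu scaleR_right_distrib power2_eq_square)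
    then have "norm r \<le> \<bar>l\<bar> * norm p + norm (W *v p)" by (metis norm_triangle_ineq4 norm_scaleR)
    also have "\<dots> \<le> w * k + w * k"
      using l np k0 w0 norm_matrix_vector_le[of W p] nW
      by (intro add_mono mult_mono order_trans[OF norm_matrix_vector_le]) auto
    finally have nr: "norm r \<le> 2 * w * k" by (simp add: mult.commute)
    \<comment> \<open>The Rayleigh quotient is the squared norm of W^T u = l u - p. By orthogonality
      of \<open>u\<close> and \<open>p\<close> it differs from l^2 only to second order.\<close>
    have uCu: "u \<bullet> (C *v u) = l\<^sup>2 + (norm p)\<^sup>2"
    proof -
      have "u \<bullet> (C *v u) = (transpose W *v u) \<bullet> (transpose W *v u)"
        using WC by (metis inner_matrix_vector_left inner_commute matrix_vector_mul_assoc)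
      then have "u \<bullet> (C *v u) = l * l * (u \<bullet> u) - 2 * l * (u \<bullet> p) + p \<bullet> p"
        unfolding Wtu by (simp add: inner_diff_left inner_diff_right inner_commute algebra_simps)
      then show ?thesis using u up by (simp add: dot_square_norm power2_eq_square)
    qed
    have Cb: "(C *v u) \<bullet> b = g b * (u \<bullet> b)" if "b \<in> B" for b
      using g[OF that] \<open>transpose C = C\<close> by (metis inner_matrix_vector_left inner_scaleR_right)
    obtain e where e: "e \<in> B" "\<bar>u \<bullet> (C *v u) - g e\<bar> \<le> 4 / \<delta> * (norm r)\<^sup>2"
      "norm (\<Sum>b | b \<in> B \<and> g b \<noteq> g e. (u \<bullet> b) *\<^sub>R b) \<le> 2 / \<delta> * norm r"
      using nearest_eigenvalue[OF B Cb u \<delta>, where \<mu> = "l\<^sup>2"] unfolding r_def by blast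
    have gnn: "g b \<ge> 0" if "b \<in> B" for b
    proof -
      have "g b = b \<bullet> (C *v b)" using g[OF that] B(3)[OF that] by (simp add: dot_square_norm)
      also have "\<dots> = (transpose W *v b) \<bullet> (transpose W *v b)"
        using WC by (metis inner_matrix_vector_left inner_commute matrix_vector_mul_assoc)
      finally show ?thesis by simp
    qed
    show ?thesis
    proof (cases "g e = 0")
      case False
      \<comment> \<open>The root with the sign of \<open>l\<close> is taken, so that
        \<open>\<bar>l + s\<bar>\<close> is at least \<open>m\<close> and can be divided out of l^2
        - s^2.\<close>
      define s where "s = (if l \<ge> 0 then sqrt (g e) else - sqrt (g e))"
      have pos: "sqrt (g e) > 0" using False gnn[OF e(1)] by simp
      have "\<bar>l\<^sup>2 - g e\<bar> \<le> \<bar>u \<bullet> (C *v u) - g e\<bar> + (norm p)\<^sup>2"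
        unfolding uCu using zero_le_power2[of "norm p"] by linarith
      also have "\<dots> \<le> 4 / \<delta> * (2 * w * k)\<^sup>2 + k\<^sup>2"
        using e(2) nr np \<delta>(1) by (intro add_mono order_trans[OF e(2)] mult_left_mono power_mono) auto
      also have "\<dots> = c1 * k\<^sup>2" by (simp add: c1_def algebra_simps power_mult_distrib)
      finally have *: "\<bar>l\<^sup>2 - g e\<bar> \<le> c1 * k\<^sup>2" .
      have "l\<^sup>2 - g e = (l - s) * (l + s)"
        using gnn[OF e(1)] by (simp add: s_def algebra_simps power2_eq_square)
      then have "\<bar>l\<^sup>2 - g e\<bar> = \<bar>l - s\<bar> * \<bar>l + s\<bar>" by (simp add: abs_mult)
      moreover have "\<bar>l - s\<bar> * m \<le> \<bar>l - s\<bar> * \<bar>l + s\<bar>"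
        using m(2)[OF e(1)] pos by (intro mult_left_mono) (auto simp: s_def)
      ultimately have "\<bar>l - s\<bar> * m \<le> c1 * k\<^sup>2" using * by linarith
      then have "\<bar>l - s\<bar> \<le> c1 / m * k\<^sup>2" using m(1) by (simp add: field_simps)
      also have "\<dots> \<le> c * k\<^sup>2" by (intro mult_right_mono) (auto simp: c_def)
      finally show ?thesis using e(1) unfolding k_def by (intro bexI[of _ s]) (auto simp: s_def T_def)
    next
      text \<open>Here $\lambda^2 = O(k^2)$ would only give $\lambda = O(k)$. The second order comes from
        $W^T n = 0$ for the component $n$ of $u$ in the kernel of $C$.\<close>
      case True
      define q where "q = (\<Sum>b | b \<in> B \<and> g b \<noteq> g e. (u \<bullet> b) *\<^sub>R b)"
      define n where "n = (\<Sum>b | b \<in> B \<and> g b = g e. (u \<bullet> b) *\<^sub>R b)"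
      have "u = (\<Sum>b\<in>B. (u \<bullet> b) *\<^sub>R b)" using B by (subst orthonormal_basis_expand) auto
      also have "\<dots> = (\<Sum>b\<in>{b \<in> B. g b = g e} \<union> {b \<in> B. g b \<noteq> g e}. (u \<bullet> b) *\<^sub>R b)"
        by (intro sum.cong) auto
      also have "\<dots> = n + q" unfolding n_def q_def
        using B(1) by (intro sum.union_disjoint) auto
      finally have unq: "u = n + q" .
      have nq: "norm q \<le> c2 * k"
        using e(3) nr \<delta>(1) unfolding q_def[symmetric] c2_def
        by (smt (verit, best) mult.assoc mult_left_mono divide_pos_pos)
      have "(norm n)\<^sup>2 \<le> 1"
      proof -
        have "(norm n)\<^sup>2 = (\<Sum>b | b \<in> B \<and> g b = g e. (u \<bullet> b)\<^sup>2)"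
          unfolding n_def using B by (intro norm_orthonormal_sum) (auto intro: pairwise_mono)
        also have "\<dots> \<le> (\<Sum>b\<in>B. (u \<bullet> b)\<^sup>2)" using B(1) by (intro sum_mono2) auto
        also have "\<dots> = 1"
          using inner_orthonormal_expand[OF B, of u u] u by (simp add: power2_eq_square dot_square_norm)
        finally show ?thesis .
      qed
      then have nn: "norm n \<le> 1" by (simp add: power_le_one_iff abs_square_le_1)
      have "C *v n = 0"
        unfolding n_def using g True
        by (simp add: linear_sum[OF matrix_vector_mul_linear] matrix_vector_mult_scaleR)
      moreover have "n \<bullet> (C *v n) = (transpose W *v n) \<bullet> (transpose W *v n)"
        using WC by (metis inner_matrix_vector_left inner_commute matrix_vector_mul_assoc)
      ultimately have Wtn: "transpose W *v n = 0" by (metis inner_eq_zero_iff inner_zero_right)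
      then have "W *v n = (W - transpose W) *v n" by (simp add: matrix_vector_mult_diff_rdistrib)
      then have "norm (W *v n) \<le> k * norm n" unfolding k_def by (metis norm_matrix_vector_le)
      also have "\<dots> \<le> k" using nn k0 by (simp add: mult_left_le)
      finally have Wn: "norm (W *v n) \<le> k" .
      \<comment> \<open>Because W^T n = 0, the quadratic form reduces to the pairing of
        \<open>q\<close> with W n + W q. Here \<open>q\<close> is of first order in
        \<open>k\<close>, and so are W n, which equals (W - W^T) n, and W q. Every product is
        therefore of second order.\<close>
      have "l = (W *v u) \<bullet> u" using u up by (simp add: Wu inner_simps dot_square_norm inner_commute)
      also have "\<dots> = u \<bullet> (transpose W *v n + transpose W *v q)"
        unfolding inner_matrix_vector_left by (subst (2) unq) (simp only: matrix_vector_right_distrib)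
      also have "\<dots> = (W *v u) \<bullet> q" unfolding Wtn by (simp add: inner_matrix_vector_left)
      also have "\<dots> = q \<bullet> (W *v n) + q \<bullet> (W *v q)"
        by (subst unq) (simp add: matrix_vector_right_distrib inner_simps inner_commute)
      finally have "\<bar>l\<bar> \<le> \<bar>q \<bullet> (W *v n)\<bar> + \<bar>q \<bullet> (W *v q)\<bar>" by simp
      also have "\<dots> \<le> norm q * norm (W *v n) + norm q * norm (W *v q)"
        by (intro add_mono Cauchy_Schwarz_ineq2)
      also have "\<dots> \<le> norm q * k + norm q * (w * norm q)"
        using Wn norm_matrix_vector_le[of W q] nW by (intro add_mono mult_left_mono) auto
      also have "\<dots> \<le> (c2 * k) * k + (c2 * k) * (w * (c2 * k))"
        using nq k0 w0 order_trans[OF norm_ge_zero nq]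
        by (intro add_mono mult_mono mult_left_mono) auto
      also have "\<dots> = (c2 + w * c2\<^sup>2) * k\<^sup>2"
        by (simp add: algebra_simps power2_eq_square)
      also have "\<dots> \<le> c * k\<^sup>2" by (intro mult_right_mono) (auto simp: c_def)
      finally show ?thesis
        using e(1) True unfolding k_def by (intro bexI[of _ 0]) (auto simp: T_def image_iff)
    qed
  qed
  moreover have "finite T" using B(1) by (simp add: T_def)
  ultimately show ?thesis by blast
qed blast

section \<open>From eigenvalues to traces and linear functionals on the Stiefel manifold\<close>

lemma trace_near_finite_set:
  fixes C :: "real^'n^'n"
  shows "\<exists>c T. finite T \<and> (\<forall>W. W ** transpose W = C \<longrightarrow>
    (\<exists>t\<in>T. \<bar>trace W - t\<bar> \<le> c * (norm (W - transpose W))\<^sup>2))"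
proof -
  obtain c T where T: "finite T" and near: "\<And>W u l. W ** transpose W = C \<Longrightarrow> norm u = 1 \<Longrightarrow>
    W *v u + transpose W *v u = (2 * l) *\<^sub>R u \<Longrightarrow> \<exists>t\<in>T. \<bar>l - t\<bar> \<le> c * (norm (W - transpose W))\<^sup>2"
    using symmetric_part_eigenvalue_near[of C] by blast
  \<comment> \<open>All sums of \<open>CARD('n)\<close> elements of \<open>T\<close>. Lists are used
    because several eigenvectors may share one nearby value.\<close>
  define T' where "T' = sum_list ` {ts. set ts \<subseteq> T \<and> length ts = CARD('n)}"
  have "\<exists>t\<in>T'. \<bar>trace W - t\<bar> \<le> real CARD('n) * c * (norm (W - transpose W))\<^sup>2"
    if WC: "W ** transpose W = C" for W
  proof -
    let ?f = "\<lambda>x. (1/2) *\<^sub>R (W *v x + transpose W *v x)"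
    have "linear ?f"
      by (intro linear_compose_scale_right linear_compose_add matrix_vector_mul_linear)
    moreover have "?f x \<bullet> y = x \<bullet> ?f y" for x y
      using inner_matrix_vector_left[of W x y] inner_matrix_vector_left[of "transpose W" x y]
      by (simp add: inner_simps del: transpose_matrix_vector)
    ultimately obtain U l where U: "finite U" "pairwise orthogonal U" "\<And>u. u \<in> U \<Longrightarrow> norm u = 1"
      "span U = UNIV" and l: "\<And>u. u \<in> U \<Longrightarrow> ?f u = l u *\<^sub>R u"
      using self_adjoint_eigenbasis[of ?f] by metis
    have eig: "W *v u + transpose W *v u = (2 * l u) *\<^sub>R u" if "u \<in> U" for u
    proof -
      have "W *v u + transpose W *v u = 2 *\<^sub>R ?f u" by simp
      then show ?thesis unfolding l[OF that] by simp
    qed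
    have lu: "u \<bullet> (W *v u) = l u" if "u \<in> U" for u
    proof -
      have "u \<bullet> (W *v u + transpose W *v u) = 2 * (u \<bullet> (W *v u))"
        using inner_matrix_vector_left[of W u u] by (simp add: inner_add_right inner_commute)
      then show ?thesis using U(3)[OF that] unfolding eig[OF that] by (simp add: dot_square_norm)
    qed
    obtain t where t: "\<And>u. u \<in> U \<Longrightarrow> t u \<in> T \<and> \<bar>l u - t u\<bar> \<le> c * (norm (W - transpose W))\<^sup>2"
      using near[OF WC U(3) eig] by metis
    have "independent U"
      using U(2,3) by (intro pairwise_orthogonal_independent) force+
    then have card: "card U = CARD('n)"
      using U(4) basis_card_eq_dim[of U UNIV] by simp
    obtain us where us: "set us = U" "distinct us" using finite_distinct_list[OF U(1)] by blast
    have "(\<Sum>u\<in>U. t u) = sum_list (map t us)" using us sum_list_distinct_conv_sum_set[of us t] by simp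
    moreover have "map t us \<in> {ts. set ts \<subseteq> T \<and> length ts = CARD('n)}"
      using us t card distinct_card[of us] by auto
    ultimately have "(\<Sum>u\<in>U. t u) \<in> T'" unfolding T'_def by blast
    moreover have "\<bar>trace W - (\<Sum>u\<in>U. t u)\<bar> \<le> real CARD('n) * c * (norm (W - transpose W))\<^sup>2"
    proof -
      \<comment> \<open>In an eigenbasis of the symmetric part of \<open>W\<close>, the diagonal
        entries of \<open>W\<close> are the eigenvalues \<open>l u\<close>.\<close>
      have "trace W = (\<Sum>u\<in>U. l u)"
        using trace_eq_sum_inner_orthonormal[OF U, of W] lu by simp
      then have "\<bar>trace W - (\<Sum>u\<in>U. t u)\<bar> = \<bar>\<Sum>u\<in>U. l u - t u\<bar>" by (simp add: sum_subtractf)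
      also have "\<dots> \<le> (\<Sum>u\<in>U. c * (norm (W - transpose W))\<^sup>2)"
        using t by (intro order_trans[OF sum_abs] sum_mono) auto
      finally show ?thesis using card by simp
    qed
    ultimately show ?thesis by blast
  qed
  moreover have "finite T'" unfolding T'_def using T by (intro finite_imageI finite_lists_length_eq)
  ultimately show ?thesis by blast
qed

text \<open>For W = M Q^T, orthonormality of the columns of \<open>Q\<close> gives W W^T = M M^T,
  and the trace of W is the inner product of \<open>M\<close> and \<open>Q\<close>. The symmetry
  hypothesis turns W - W^T into Q v^T - v Q^T, whose norm is at most a constant times that of
  \<open>v\<close>.\<close>

lemma stiefel_linear_values:
  fixes M :: "real^'k^'d"
  shows "\<exists>c T. finite T \<and> (\<forall>Q\<in>stiefel. \<forall>v. (v + M) ** transpose Q = Q ** transpose (v + M) \<longrightarrow>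
    (\<exists>t\<in>T. \<bar>M \<bullet> Q - t\<bar> \<le> c * (norm v)\<^sup>2))"
proof -
  obtain c T where T: "finite T" and near: "\<And>W. W ** transpose W = M ** transpose M \<Longrightarrow>
    \<exists>t\<in>T. \<bar>trace W - t\<bar> \<le> c * (norm (W - transpose W))\<^sup>2"
    using trace_near_finite_set[of "M ** transpose M"] by blast
  \<comment> \<open>The Frobenius norm of every point of the Stiefel manifold. Below,
    \<open>max c 0\<close> replaces \<open>c\<close>, which may be negative, to make the bound
    monotone in the norm.\<close>
  let ?K = "sqrt (real CARD('k))"
  have "\<exists>t\<in>T. \<bar>M \<bullet> Q - t\<bar> \<le> (max c 0 * (2 * ?K)\<^sup>2) * (norm v)\<^sup>2"
    if Q: "Q \<in> stiefel" and sym: "(v + M) ** transpose Q = Q ** transpose (v + M)" for Q v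
  proof -
    have QQ: "transpose Q ** Q = mat 1" using Q by (simp add: stiefel_def)
    define W where "W = M ** transpose Q"
    have "W ** transpose W = M ** (transpose Q ** Q) ** transpose M"
      by (simp add: W_def matrix_transpose_mul matrix_mul_assoc)
    then have "W ** transpose W = M ** transpose M" using QQ by simp
    from near[OF this] obtain t where t: "t \<in> T" "\<bar>trace W - t\<bar> \<le> c * (norm (W - transpose W))\<^sup>2" by blast
    have nQ: "norm Q = ?K"
      using norm_square_eq_trace[of "transpose Q"] QQ
      by (simp add: norm_transpose trace_I real_sqrt_unique)
    have add: "transpose (v + M) = transpose v + transpose M" by (simp add: transpose_def vec_eq_iff)
    have add_mult: "(v + M) ** transpose Q = v ** transpose Q + M ** transpose Q"
      by (simp add: vec_eq_iff matrix_matrix_mult_def distrib_right sum.distrib)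
    have "W - transpose W = Q ** transpose v - v ** transpose Q"
      using sym unfolding add add_mult by (simp add: W_def matrix_transpose_mul matrix_add_ldistrib algebra_simps)
    then have "norm (W - transpose W) \<le> norm (Q ** transpose v) + norm (v ** transpose Q)"
      by (metis norm_triangle_ineq4)
    also have "\<dots> \<le> norm Q * norm v + norm v * norm Q"
      by (intro add_mono) (metis norm_matrix_mul_le norm_transpose)+
    finally have "norm (W - transpose W) \<le> 2 * ?K * norm v" unfolding nQ by (simp add: mult_ac)
    then have "(norm (W - transpose W))\<^sup>2 \<le> (2 * ?K * norm v)\<^sup>2" by (rule power_mono) simp
    then have "c * (norm (W - transpose W))\<^sup>2 \<le> max c 0 * (2 * ?K * norm v)\<^sup>2"
      by (intro mult_mono max.cobounded1 max.cobounded2 zero_le_power2)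
    also have "\<dots> = (max c 0 * (2 * ?K)\<^sup>2) * (norm v)\<^sup>2" by (simp only: power_mult_distrib mult.assoc)
    finally have "\<bar>trace W - t\<bar> \<le> (max c 0 * (2 * ?K)\<^sup>2) * (norm v)\<^sup>2" using t(2) by linarith
    then show ?thesis using t(1) by (auto simp: W_def inner_matrix_trace)
  qed
  with T show ?thesis by blast
qed

section \<open>Subdifferentials\<close>

text \<open>Let \<open>g\<close> be a lower bound for the distance from \<open>F x0\<close> to the
  other elements of \<open>T\<close>. By continuity \<open>F x\<close> stays within
  \<open>g / 2\<close> of \<open>F x0\<close> near \<open>x0\<close>, so no element of
  \<open>T\<close> is closer to \<open>F x\<close> than \<open>F x0\<close> is. The bound for the
  distance to \<open>T\<close> thus holds for \<open>\<bar>F x - F x0\<bar>\<close>, and its square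
  root is the claim.\<close>

lemma lojasiewicz_half_if_near_finite_set:
  fixes f :: "'a::euclidean_space \<Rightarrow> ereal"
  assumes f: "\<And>x. x \<in> S \<Longrightarrow> f x = ereal (F x)" and cont: "continuous_on S F" and "finite T"
    and near: "\<And>x v. x \<in> S \<Longrightarrow> v \<in> limiting_subdiff f x \<Longrightarrow> \<exists>t\<in>T. \<bar>F x - t\<bar> \<le> c * (norm v)\<^sup>2"
    and x0: "x0 \<in> S"
  shows "\<exists>\<epsilon> \<eta>. 0 < \<epsilon> \<and> \<epsilon> < 1 \<and> 0 < \<eta> \<and> (\<forall>x\<in>S. norm (x - x0) \<le> \<epsilon> \<longrightarrow>
    dist0 (limiting_subdiff f x) \<ge> ereal (\<eta> * sqrt \<bar>real_of_ereal (f x) - real_of_ereal (f x0)\<bar>))"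
proof -
  obtain g where g: "g > 0" "\<And>t. t \<in> T \<Longrightarrow> t \<noteq> F x0 \<Longrightarrow> g \<le> \<bar>F x0 - t\<bar>"
    using finite_set_avoid[OF \<open>finite T\<close>, of "F x0"] by (auto simp: dist_real_def)
  obtain d where d: "d > 0" "\<And>x. x \<in> S \<Longrightarrow> dist x x0 < d \<Longrightarrow> dist (F x) (F x0) < g / 2"
    using cont x0 g(1) unfolding continuous_on_iff by (metis half_gt_zero)
  define \<epsilon> where "\<epsilon> = min (1/2) (d/2)"
  define k where "k = max c 1"
  have "ereal (1 / sqrt k * sqrt \<bar>real_of_ereal (f x) - real_of_ereal (f x0)\<bar>) \<le> dist0 (limiting_subdiff f x)"
    if x: "x \<in> S" and le: "norm (x - x0) \<le> \<epsilon>" for x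
    unfolding dist0_def
  \<comment> \<open>This also covers an empty subdifferential, for which the infimum is
    infinite.\<close>
  proof (rule INF_greatest)
    fix v assume v: "v \<in> limiting_subdiff f x"
    have k: "k > 0" by (simp add: k_def)
    obtain t where t: "t \<in> T" "\<bar>F x - t\<bar> \<le> c * (norm v)\<^sup>2" using near[OF x v] by blast
    have "c * (norm v)\<^sup>2 \<le> k * (norm v)\<^sup>2" by (intro mult_right_mono) (auto simp: k_def)
    moreover have "\<bar>F x - F x0\<bar> \<le> \<bar>F x - t\<bar>"
    proof (cases "t = F x0")
      case False
      have "\<bar>F x - F x0\<bar> < g / 2"
        using d(2)[OF x] le d(1) by (simp add: \<epsilon>_def dist_norm)
      then show ?thesis using g(2)[OF t(1) False] by linarith
    qed simp
    ultimately have "\<bar>F x - F x0\<bar> \<le> k * (norm v)\<^sup>2" using t(2) by linarith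
    then have "sqrt \<bar>F x - F x0\<bar> \<le> sqrt (k * (norm v)\<^sup>2)" by (rule real_sqrt_le_mono)
    then have "1 / sqrt k * sqrt \<bar>F x - F x0\<bar> \<le> norm v"
      using k by (simp add: real_sqrt_mult field_simps)
    then show "ereal (1 / sqrt k * sqrt \<bar>real_of_ereal (f x) - real_of_ereal (f x0)\<bar>) \<le> ereal (norm v)"
      using f x x0 by simp
  qed
  moreover have "0 < \<epsilon>" "\<epsilon> < 1" "0 < 1 / sqrt k" using d(1) by (auto simp: \<epsilon>_def k_def)
  ultimately show ?thesis by blast
qed

section \<open>First-order consequences of being a Frechet or limiting subgradient\<close>

lemma limiting_subdiff_closed_graph:
  assumes "\<And>x v. v \<in> frechet_subdiff f x \<Longrightarrow> (x, v) \<in> G" "closed G" "v \<in> limiting_subdiff f x"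
  shows "(x, v) \<in> G"
proof -
  obtain xs vs where s: "xs \<longlonglongrightarrow> x" "vs \<longlonglongrightarrow> v" "\<And>k. vs k \<in> frechet_subdiff f (xs k)"
    using assms(3) by (auto simp: limiting_subdiff_def)
  then have lim: "(\<lambda>k. (xs k, vs k)) \<longlonglongrightarrow> (x, v)" by (intro tendsto_Pair)
  have "(xs k, vs k) \<in> G" for k using assms(1) s(3) by simp
  then show ?thesis using lim by (rule closed_sequentially[OF assms(2)])
qed

lemma frechet_subdiff_lower_bound:
  assumes "v \<in> frechet_subdiff f x" "e > 0"
  shows "\<forall>\<^sub>F y in nhds x. f x + ereal (v \<bullet> (y - x) - e * norm (y - x)) \<le> f y"
proof -
  have fin: "\<bar>f x\<bar> \<noteq> \<infinity>" and lim: "0 \<le> Liminf (at x) (\<lambda>y. (f y - f x - ereal (v \<bullet> (y - x))) / ereal (norm (y - x)))"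
    using assms(1) by (auto simp: frechet_subdiff_def)
  obtain a where a: "f x = ereal a" using fin by auto
  have "ereal (- e) < 0" using assms(2) by simp
  with lim have "\<forall>\<^sub>F y in at x. ereal (- e) < (f y - f x - ereal (v \<bullet> (y - x))) / ereal (norm (y - x))"
    unfolding le_Liminf_iff by blast
  then have "\<forall>\<^sub>F y in at x. f x + ereal (v \<bullet> (y - x) - e * norm (y - x)) \<le> f y"
    using eventually_neq_at_within[of x x UNIV]
  proof eventually_elim
    case (elim y)
    then show ?case using a by (cases "f y") (auto simp: field_simps)
  qed
  \<comment> \<open>At \<open>y = x\<close> the two sides agree, so the punctured neighbourhood may
    be replaced by a full one. Curves may then return to \<open>x\<close>.\<close>
  then show ?thesis
    unfolding eventually_at_filter by eventually_elim (auto simp: a)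
qed

text \<open>Along the curve \<open>f\<close> lies below a linear function that it touches at
  \<open>x\<close>. Dividing the subgradient inequality by t > 0 and letting t tend to 0 gives one
  sign; the reversed curve gives the other. An inequality along the curve suits
  \<open>ell_fun\<close>, which is a minimum of linear functions on the Stiefel manifold.\<close>

lemma frechet_subdiff_curve:
  fixes c :: "real \<Rightarrow> 'a::euclidean_space"
  assumes v: "v \<in> frechet_subdiff f x" and c: "(c has_vector_derivative c') (at 0)" "c 0 = x"
    and le: "\<And>t. f (c t) \<le> ereal (- (m \<bullet> c t))" and eq: "f x = ereal (- (m \<bullet> x))"
  shows "(v + m) \<bullet> c' = 0"
proof -
  have half: "(v + m) \<bullet> b' \<le> 0"
    if b: "(b has_vector_derivative b') (at 0)" "b 0 = x" and le: "\<And>t. f (b t) \<le> ereal (- (m \<bullet> b t))" for b b'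
  proof -
    have "(v + m) \<bullet> b' \<le> e * norm b'" if "e > 0" for e
    proof -
      let ?q = "\<lambda>t. (b t - b 0) /\<^sub>R t"
      have q: "(?q \<longlongrightarrow> b') (at_right 0)"
      proof (rule Lim_transform_eventually)
        have "(b has_vector_derivative b') (at_right 0)"
          by (rule has_vector_derivative_at_within[OF b(1)])
        then have "((\<lambda>t. (1 / norm (t - 0)) *\<^sub>R (b t - (b 0 + (t - 0) *\<^sub>R b'))) \<longlongrightarrow> 0) (at_right 0)"
          unfolding has_vector_derivative_def has_derivative_within by blast
        from tendsto_add[OF this tendsto_const[of b']]
        show "((\<lambda>t. (1 / norm (t - 0)) *\<^sub>R (b t - (b 0 + (t - 0) *\<^sub>R b')) + b') \<longlongrightarrow> b') (at_right 0)"
          by simp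
        show "\<forall>\<^sub>F t in at_right 0. (1 / norm (t - 0)) *\<^sub>R (b t - (b 0 + (t - 0) *\<^sub>R b')) + b' = ?q t"
          using eventually_at_right_less[of "0::real"]
          by eventually_elim (simp add: algebra_simps divide_inverse)
      qed
      have "(b \<longlongrightarrow> x) (at_right 0)"
        using has_vector_derivative_continuous[OF b(1)] b(2)
        by (metis continuous_at_split continuous_within)
      with frechet_subdiff_lower_bound[OF v that]
      have "\<forall>\<^sub>F t in at_right 0. f x + ereal (v \<bullet> (b t - x) - e * norm (b t - x)) \<le> f (b t)"
        by (rule eventually_compose_filterlim)
      then have "\<forall>\<^sub>F t in at_right 0. (v + m) \<bullet> ?q t \<le> e * norm (?q t)"
        using eventually_at_right_less
      proof eventually_elim
        case (elim t)
        have "ereal (- (m \<bullet> x)) + ereal (v \<bullet> (b t - x) - e * norm (b t - x)) \<le> ereal (- (m \<bullet> b t))"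
          using order_trans[OF elim(1) le[of t]] unfolding eq .
        then have "(v + m) \<bullet> (b t - x) \<le> e * norm (b t - x)"
          by (simp add: inner_simps)
        from mult_left_mono[OF this, of "inverse t"] elim(2) show ?case by (simp add: b(2) mult.left_commute)
      qed
      moreover have "((\<lambda>t. (v + m) \<bullet> ?q t) \<longlongrightarrow> (v + m) \<bullet> b') (at_right 0)"
        "((\<lambda>t. e * norm (?q t)) \<longlongrightarrow> e * norm b') (at_right 0)"
        using q by (intro tendsto_intros; assumption)+
      ultimately show ?thesis using tendsto_le[OF trivial_limit_at_right_real] by blast
    qed
    note bound = this
    show ?thesis
    proof (rule field_le_epsilon)
      fix e :: real assume "e > 0"
      \<comment> \<open>The bound is applied with \<open>e / (norm b' + 1)\<close>, whose product
        with \<open>norm b'\<close> is at most \<open>e\<close> even when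
        \<open>b' = 0\<close>.\<close>
      have "norm b' / (norm b' + 1) \<le> 1" by (simp add: divide_simps add_nonneg_pos)
      then have "e / (norm b' + 1) * norm b' \<le> e"
        using mult_left_mono[of "norm b' / (norm b' + 1)" 1 e] \<open>e > 0\<close> by simp
      moreover have "e / (norm b' + 1) > 0" using \<open>e > 0\<close> by (simp add: add_nonneg_pos)
      ultimately show "(v + m) \<bullet> b' \<le> 0 + e" using bound[of "e / (norm b' + 1)"] by linarith
    qed
  qed
  have "((\<lambda>t::real. - t) has_vector_derivative - 1) (at 0)"
    by (auto intro!: derivative_eq_intros)
  from vector_diff_chain_at[OF this, of c c'] c(1)
  have "((\<lambda>t. c (- t)) has_vector_derivative - c') (at 0)" by (simp add: o_def)
  from half[OF this] half[OF c le] c(2) le show ?thesis by simp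
qed

section \<open>Normal vectors of the Stiefel manifold\<close>

lemma stiefel_iff: "Q \<in> stiefel \<longleftrightarrow> (\<forall>a b. (\<Sum>k\<in>UNIV. Q $ k $ a * Q $ k $ b) = (if a = b then 1 else 0))"
  by (simp add: stiefel_def vec_eq_iff matrix_matrix_mult_def transpose_def mat_def)

text \<open>For distinct \<open>i\<close> and \<open>j\<close> this is \<open>Q\<close> multiplied
  on the left by a Givens rotation of angle \<open>t\<close>. Written as \<open>Q\<close> plus
  scalar multiples of fixed matrices, it is easy to differentiate.\<close>

definition rotation_curve :: "'d \<Rightarrow> 'd \<Rightarrow> real^'k^'d \<Rightarrow> real \<Rightarrow> real^'k^'d" where
  "rotation_curve i j Q t = Q + (cos t - 1) *\<^sub>R (\<chi> k. if k = i \<or> k = j then Q $ k else 0)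
     + sin t *\<^sub>R (\<chi> k. if k = i then - Q $ j else if k = j then Q $ i else 0)"

text \<open>Only rows \<open>i\<close> and \<open>j\<close> change, and their joint contribution to
  each entry of the Gram matrix is multiplied by cos^2 + sin^2 = 1.\<close>

lemma rotation_curve_stiefel:
  fixes Q :: "real^'k^'d"
  assumes "i \<noteq> j" "Q \<in> stiefel"
  shows "rotation_curve i j Q t \<in> stiefel"
proof -
  let ?R = "rotation_curve i j Q t"
  have split: "(\<Sum>k\<in>UNIV. f k) = f i + f j + (\<Sum>k\<in>UNIV - {i, j}. f k)" for f :: "'d \<Rightarrow> real"
    using assms(1) sum.subset_diff[of "{i, j}" UNIV f] by (simp add: add.commute)
  have "(\<Sum>k\<in>UNIV. ?R $ k $ a * ?R $ k $ b) = (\<Sum>k\<in>UNIV. Q $ k $ a * Q $ k $ b)" for a b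
  proof -
    have rows: "?R $ i $ x = cos t * Q $ i $ x - sin t * Q $ j $ x"
      "?R $ j $ x = cos t * Q $ j $ x + sin t * Q $ i $ x" for x
      using assms(1) by (auto simp: rotation_curve_def algebra_simps)
    have "(\<Sum>k\<in>UNIV - {i, j}. ?R $ k $ a * ?R $ k $ b) = (\<Sum>k\<in>UNIV - {i, j}. Q $ k $ a * Q $ k $ b)"
      by (intro sum.cong) (auto simp: rotation_curve_def)
    moreover have "?R $ i $ a * ?R $ i $ b + ?R $ j $ a * ?R $ j $ b =
      ((cos t)\<^sup>2 + (sin t)\<^sup>2) * (Q $ i $ a * Q $ i $ b + Q $ j $ a * Q $ j $ b)"
      unfolding rows by (simp only: power2_eq_square algebra_simps)
    ultimately show ?thesis by (subst (1 2) split) simp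
  qed
  then show ?thesis using assms(2) unfolding stiefel_iff by simp
qed

lemma rotation_curve_0: "rotation_curve i j Q 0 = Q"
  by (simp add: rotation_curve_def)

lemma rotation_curve_derivative:
  "(rotation_curve i j Q has_vector_derivative
     (\<chi> k. if k = i then - Q $ j else if k = j then Q $ i else 0)) (at 0)"
  unfolding rotation_curve_def[abs_def]
  by (auto intro!: derivative_eq_intros)

text \<open>This is symmetry of V Q^T, read off entrywise. For \<open>Q\<close> in
  \<open>stiefel\<close> it describes the normal space, the matrices Q S with S symmetric.\<close>

definition normal_to_stiefel :: "real^'k^'d \<Rightarrow> real^'k^'d \<Rightarrow> bool" where
  "normal_to_stiefel Q V \<longleftrightarrow> (\<forall>i j. V $ i \<bullet> Q $ j = V $ j \<bullet> Q $ i)"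

text \<open>The test directions are the initial velocities of the rotation curves. Pairing one with
  \<open>V\<close> gives the difference of the entries (j, i) and (i, j) of V Q^T.\<close>

lemma normal_to_stiefelI:
  assumes "\<And>i j. i \<noteq> j \<Longrightarrow> V \<bullet> (\<chi> k. if k = i then - Q $ j else if k = j then Q $ i else 0) = 0"
  shows "normal_to_stiefel Q V"
  unfolding normal_to_stiefel_def
proof (intro allI)
  fix i j
  show "V $ i \<bullet> Q $ j = V $ j \<bullet> Q $ i"
  proof (cases "i = j")
    case False
    have "V \<bullet> (\<chi> k. if k = i then - Q $ j else if k = j then Q $ i else 0) =
       (\<Sum>k\<in>UNIV. (if k = i then - (V $ i \<bullet> Q $ j) else 0) + (if k = j then V $ j \<bullet> Q $ i else 0))"
      unfolding inner_vec_def[of V] using False by (intro sum.cong) auto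
    also have "\<dots> = - (V $ i \<bullet> Q $ j) + V $ j \<bullet> Q $ i" by (simp add: sum.distrib)
    finally show ?thesis using assms[OF False] by simp
  qed simp
qed

lemma closed_normal_to_stiefel: "closed {(Q, V). normal_to_stiefel Q (V + M)}"
  unfolding normal_to_stiefel_def case_prod_unfold
  by (intro closed_Collect_all closed_Collect_eq continuous_intros)

lemma stiefel_linear_values_finite:
  fixes Ms :: "(real^'k^'d) set"
  assumes "finite Ms"
  shows "\<exists>c T. finite T \<and> (\<forall>M\<in>Ms. \<forall>Q\<in>stiefel. \<forall>v. normal_to_stiefel Q (v + M) \<longrightarrow>
    (\<exists>t\<in>T. \<bar>M \<bullet> Q - t\<bar> \<le> c * (norm v)\<^sup>2))"
proof -
  let ?near = "\<lambda>M c T. finite T \<and> (\<forall>Q\<in>stiefel. \<forall>v::real^'k^'d. normal_to_stiefel Q (v + M) \<longrightarrow>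
    (\<exists>t\<in>T. \<bar>M \<bullet> Q - t\<bar> \<le> c * (norm v)\<^sup>2))"
  have "\<forall>M. \<exists>c T. ?near M c T"
  proof
    fix M :: "real^'k^'d"
    have "(v + M) ** transpose Q = Q ** transpose (v + M)" if "normal_to_stiefel Q (v + M)" for Q v
      using that unfolding normal_to_stiefel_def
      by (simp add: vec_eq_iff matrix_matrix_mult_def transpose_def inner_vec_def mult.commute)
    with stiefel_linear_values[of M] show "\<exists>c T. ?near M c T" by meson
  qed
  from choice[OF this] obtain c where "\<forall>M. \<exists>T. ?near M (c M) T" by (rule exE)
  from choice[OF this] obtain T where "\<forall>M. ?near M (c M) (T M)" by (rule exE)
  then have cT: "\<And>M. finite (T M)"
    "\<And>M Q v. Q \<in> stiefel \<Longrightarrow> normal_to_stiefel Q (v + M) \<Longrightarrow> \<exists>t\<in>T M. \<bar>M \<bullet> Q - t\<bar> \<le> c M * (norm v)\<^sup>2"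
    by simp_all
  \<comment> \<open>The union of the finite sets and the sum of the absolute constants serve all
    \<open>M\<close> in \<open>Ms\<close> at once.\<close>
  have "\<exists>t\<in>(\<Union>M\<in>Ms. T M). \<bar>M \<bullet> Q - t\<bar> \<le> (\<Sum>M\<in>Ms. \<bar>c M\<bar>) * (norm v)\<^sup>2"
    if M: "M \<in> Ms" and Q: "Q \<in> stiefel" "normal_to_stiefel Q (v + M)" for M Q v
  proof -
    obtain t where t: "t \<in> T M" "\<bar>M \<bullet> Q - t\<bar> \<le> c M * (norm v)\<^sup>2" using cT(2)[OF Q] by blast
    have "c M \<le> (\<Sum>M\<in>Ms. \<bar>c M\<bar>)"
      using member_le_sum[of M Ms "\<lambda>M. \<bar>c M\<bar>"] assms M by auto
    then have "c M * (norm v)\<^sup>2 \<le> (\<Sum>M\<in>Ms. \<bar>c M\<bar>) * (norm v)\<^sup>2" by (rule mult_right_mono) simp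
    then show ?thesis using t M by (intro bexI[of _ t]) auto
  qed
  moreover have "finite (\<Union>M\<in>Ms. T M)" using assms cT(1) by blast
  ultimately show ?thesis by blast
qed

section \<open>The two objective functions\<close>

lemma finite_binmats: "finite (binmats :: (real^'k^'n) set)"
proof (rule finite_subset)
  show "(binmats :: (real^'k^'n) set) \<subseteq> (\<lambda>A. \<chi> i j. if (i, j) \<in> A then 1 else - 1) ` UNIV"
  proof
    fix P :: "real^'k^'n" assume "P \<in> binmats"
    then have "P = (\<chi> i j. if (i, j) \<in> {(i, j). P $ i $ j = 1} then 1 else - 1)"
      by (auto simp: binmats_def vec_eq_iff)
    then show "P \<in> (\<lambda>A. \<chi> i j. if (i, j) \<in> A then 1 else - 1) ` UNIV" by blast
  qed
qed simp

text \<open>Moving \<open>X\<close> to the other factor exhibits the coupling term as a linear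
  functional of \<open>Q\<close> with coefficient matrix \<open>X ** P\<close>.\<close>

lemma frob_inner_eq_inner: "frob_inner P (transpose X ** Q) = (X ** P) \<bullet> Q"
proof -
  have "frob_inner P (transpose X ** Q) = trace (transpose (X ** P) ** Q)"
    by (simp add: frob_inner_def matrix_transpose_mul matrix_mul_assoc)
  also have "\<dots> = trace (Q ** transpose (X ** P))" by (rule trace_mul_sym)
  also have "\<dots> = (X ** P) \<bullet> Q" by (simp add: inner_matrix_trace[symmetric] inner_commute)
  finally show ?thesis .
qed

lemma frob_inner_eq_sum: "frob_inner A B = (\<Sum>i\<in>UNIV. \<Sum>j\<in>UNIV. A $ i $ j * B $ i $ j)"
  by (simp add: frob_inner_def trace_def matrix_matrix_mult_def transpose_def) (rule sum.swap)

lemma frob_inner_le_l1norm: "P \<in> binmats \<Longrightarrow> frob_inner P A \<le> l1norm A"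
  unfolding frob_inner_eq_sum l1norm_def
proof (intro sum_mono)
  fix i j assume "P \<in> binmats"
  then have "P $ i $ j = -1 \<or> P $ i $ j = 1" by (simp add: binmats_def)
  then show "P $ i $ j * A $ i $ j \<le> \<bar>A $ i $ j\<bar>" by auto
qed

lemma l1norm_attained: "\<exists>P\<in>binmats. frob_inner P A = l1norm A"
proof
  \<comment> \<open>The entrywise sign, with zero entries sent to 1 so that the matrix stays in
    \<open>binmats\<close>.\<close>
  let ?P = "\<chi> i j. if A $ i $ j \<ge> 0 then 1 else (- 1 :: real)"
  show "?P \<in> binmats" by (simp add: binmats_def)
  show "frob_inner ?P A = l1norm A"
    unfolding frob_inner_eq_sum l1norm_def by (intro sum.cong) auto
qed

section \<open>The objectives on their feasible sets and the normality of their subgradients\<close>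

lemma ell_fun_stiefel: "Q \<in> stiefel \<Longrightarrow> ell_fun X Q = ereal (- l1norm (transpose X ** Q))"
  by (simp add: ell_fun_def indic_def)

lemma h_fun_feasible: "Z \<in> binmats \<times> stiefel \<Longrightarrow> h_fun X Z = ereal (- ((X ** fst Z) \<bullet> snd Z))"
  by (auto simp: h_fun_def indic_def frob_inner_eq_inner)

text \<open>For a sign matrix \<open>P\<close> attaining the l1 norm at \<open>Q\<close>, the linear
  function with coefficient -X P lies above \<open>ell_fun\<close> on the Stiefel manifold and
  touches it at \<open>Q\<close>. The curve criterion therefore applies to every rotation
  curve.\<close>

lemma frechet_subdiff_ell_fun:
  fixes X :: "real^'n^'d" and Q :: "real^'k^'d"
  assumes v: "v \<in> frechet_subdiff (ell_fun X) Q" and P: "P \<in> binmats"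
    "(X ** P) \<bullet> Q = l1norm (transpose X ** Q)"
  shows "normal_to_stiefel Q (v + X ** P)"
proof (rule normal_to_stiefelI)
  fix i j :: 'd assume ij: "i \<noteq> j"
  have Q: "Q \<in> stiefel" using v by (auto simp: frechet_subdiff_def ell_fun_def indic_def split: if_splits)
  show "(v + X ** P) \<bullet> (\<chi> k. if k = i then - Q $ j else if k = j then Q $ i else 0) = 0"
  proof (rule frechet_subdiff_curve[OF v rotation_curve_derivative rotation_curve_0])
    show "ell_fun X Q = ereal (- ((X ** P) \<bullet> Q))" by (simp add: ell_fun_stiefel[OF Q] P(2))
    show "ell_fun X (rotation_curve i j Q t) \<le> ereal (- ((X ** P) \<bullet> rotation_curve i j Q t))" for t
      using frob_inner_le_l1norm[OF P(1)]
      by (simp add: ell_fun_stiefel rotation_curve_stiefel[OF ij Q] frob_inner_eq_inner[symmetric])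
  qed
qed

lemma frechet_subdiff_h_fun:
  fixes X :: "real^'n^'d" and Z :: "(real^'k^'n) \<times> (real^'k^'d)"
  assumes v: "v \<in> frechet_subdiff (h_fun X) Z"
  shows "normal_to_stiefel (snd Z) (snd v + X ** fst Z)"
proof (rule normal_to_stiefelI)
  fix i j :: 'd assume ij: "i \<noteq> j"
  have Z: "fst Z \<in> binmats" "snd Z \<in> stiefel"
    using v by (auto simp: frechet_subdiff_def h_fun_def indic_def split: if_splits)
  let ?D = "\<chi> k. if k = i then - snd Z $ j else if k = j then snd Z $ i else 0"
  \<comment> \<open>The curve keeps the sign matrix fixed and rotates only the second component, so
    the objective is exactly linear along it.\<close>
  have "(v + (0, X ** fst Z)) \<bullet> (0, ?D) = 0"
  proof (rule frechet_subdiff_curve[OF v])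
    show "((\<lambda>t. (fst Z, rotation_curve i j (snd Z) t)) has_vector_derivative (0, ?D)) (at 0)"
      by (intro has_vector_derivative_Pair has_vector_derivative_const rotation_curve_derivative)
    show "(fst Z, rotation_curve i j (snd Z) 0) = Z" by (simp add: rotation_curve_0)
    show "h_fun X Z = ereal (- ((0, X ** fst Z) \<bullet> Z))"
      using h_fun_feasible[of Z X] Z by (simp add: mem_Times_iff inner_prod_def)
    show "h_fun X (fst Z, rotation_curve i j (snd Z) t) \<le>
      ereal (- ((0, X ** fst Z) \<bullet> (fst Z, rotation_curve i j (snd Z) t)))" for t
      using Z rotation_curve_stiefel[OF ij Z(2)] by (simp add: h_fun_feasible)
  qed
  then show "(snd v + X ** fst Z) \<bullet> ?D = 0" by (simp add: inner_prod_def)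
qed

text \<open>The attaining sign matrix may vary along the approximating sequence. As there are
  finitely many of them, the union over \<open>P\<close> of the closed relations is closed and
  contains the limit.\<close>

lemma limiting_subdiff_ell_fun:
  fixes X :: "real^'n^'d" and Q :: "real^'k^'d"
  assumes "v \<in> limiting_subdiff (ell_fun X) Q"
  shows "\<exists>P\<in>binmats. (X ** P) \<bullet> Q = l1norm (transpose X ** Q) \<and> normal_to_stiefel Q (v + X ** P)"
proof -
  let ?G = "\<Union>P\<in>binmats. {z::(real^'k^'d) \<times> (real^'k^'d). (X ** P) \<bullet> fst z = l1norm (transpose X ** fst z)} \<inter>
    {(Q, v). normal_to_stiefel Q (v + X ** P)}"
  have "(Q, v) \<in> ?G"
  proof (rule limiting_subdiff_closed_graph[OF _ _ assms])
    fix Q :: "real^'k^'d" and v assume v: "v \<in> frechet_subdiff (ell_fun X) Q"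
    obtain P where P: "P \<in> binmats" "(X ** P) \<bullet> Q = l1norm (transpose X ** Q)"
      using l1norm_attained[of "transpose X ** Q"] unfolding frob_inner_eq_inner by blast
    with frechet_subdiff_ell_fun[OF v] show "(Q, v) \<in> ?G" by auto
  next
    show "closed ?G"
      by (intro closed_UN closed_Int finite_binmats ballI closed_normal_to_stiefel closed_Collect_eq)
        (auto simp: l1norm_def matrix_matrix_mult_def intro!: continuous_intros)
  qed
  then show ?thesis by auto
qed

lemma limiting_subdiff_h_fun:
  fixes X :: "real^'n^'d" and Z :: "(real^'k^'n) \<times> (real^'k^'d)"
  assumes "v \<in> limiting_subdiff (h_fun X) Z"
  shows "normal_to_stiefel (snd Z) (snd v + X ** fst Z)"
proof -
  let ?G = "{(Z, v). normal_to_stiefel (snd Z) (snd v + X ** fst Z)}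
    :: (((real^'k^'n) \<times> (real^'k^'d)) \<times> ((real^'k^'n) \<times> (real^'k^'d))) set"
  have "(Z, v) \<in> ?G"
  proof (rule limiting_subdiff_closed_graph[OF _ _ assms])
    show "closed ?G"
      unfolding normal_to_stiefel_def case_prod_unfold
      by (intro closed_Collect_all closed_Collect_eq)
        (auto simp: matrix_matrix_mult_def intro!: continuous_intros)
  qed (simp add: frechet_subdiff_h_fun)
  then show ?thesis by simp
qed

theorem theorem1:
  fixes X :: "real^'n^'d"
  assumes "CARD('k) \<le> CARD('n)" and "CARD('k) \<le> CARD('d)"
  shows "(\<forall>Qs::real^'k^'d. Qs \<in> stiefel \<and> limiting_critical (ell_fun X) Qs \<longrightarrow>
           (\<exists>\<epsilon> \<eta>. 0 < \<epsilon> \<and> \<epsilon> < 1 \<and> 0 < \<eta> \<and>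
              (\<forall>Q\<in>stiefel. norm (Q - Qs) \<le> \<epsilon> \<longrightarrow>
                 dist0 (limiting_subdiff (ell_fun X) Q)
                   \<ge> ereal (\<eta> * sqrt \<bar>real_of_ereal (ell_fun X Q) - real_of_ereal (ell_fun X Qs)\<bar>))))
       \<and> (\<forall>Zs::((real^'k^'n) \<times> (real^'k^'d)). Zs \<in> binmats \<times> stiefel \<and> limiting_critical (h_fun X) Zs \<longrightarrow>
           (\<exists>\<epsilon> \<eta>. 0 < \<epsilon> \<and> \<epsilon> < 1 \<and> 0 < \<eta> \<and>
              (\<forall>Z\<in>binmats \<times> stiefel. norm (Z - Zs) \<le> \<epsilon> \<longrightarrow>
                 dist0 (limiting_subdiff (h_fun X) Z)
                   \<ge> ereal (\<eta> * sqrt \<bar>real_of_ereal (h_fun X Z) - real_of_ereal (h_fun X Zs)\<bar>))))"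
proof -
  have "finite ((\<lambda>P. X ** P) ` (binmats :: (real^'k^'n) set))" using finite_binmats by blast
  from stiefel_linear_values_finite[OF this] obtain c T where T: "finite T"
    and near: "\<And>P Q v. P \<in> (binmats :: (real^'k^'n) set) \<Longrightarrow> Q \<in> stiefel \<Longrightarrow>
      normal_to_stiefel Q (v + X ** P) \<Longrightarrow> \<exists>t\<in>T. \<bar>(X ** P) \<bullet> Q - t\<bar> \<le> c * (norm v)\<^sup>2"
    by blast
  \<comment> \<open>Both objectives are negatives of the inner products controlled by
    \<open>near\<close>, so their values are compared with the reflected set.\<close>
  have neg: "\<exists>t\<in>uminus ` T. \<bar>- y - t\<bar> \<le> z" if "\<exists>t\<in>T. \<bar>y - t\<bar> \<le> z" for y z
    using that by (force simp: abs_minus_commute)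
  show ?thesis
  proof (intro conjI allI impI; elim conjE)
    fix Qs :: "real^'k^'d" assume Qs: "Qs \<in> stiefel"
    show "\<exists>\<epsilon> \<eta>. 0 < \<epsilon> \<and> \<epsilon> < 1 \<and> 0 < \<eta> \<and>
              (\<forall>Q\<in>stiefel. norm (Q - Qs) \<le> \<epsilon> \<longrightarrow>
                 dist0 (limiting_subdiff (ell_fun X) Q)
                   \<ge> ereal (\<eta> * sqrt \<bar>real_of_ereal (ell_fun X Q) - real_of_ereal (ell_fun X Qs)\<bar>))"
    proof (rule lojasiewicz_half_if_near_finite_set[OF ell_fun_stiefel])
      show "continuous_on stiefel (\<lambda>Q::real^'k^'d. - l1norm (transpose X ** Q))"
        by (auto simp: l1norm_def matrix_matrix_mult_def intro!: continuous_intros)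
      fix Q v :: "real^'k^'d" assume "Q \<in> stiefel" "v \<in> limiting_subdiff (ell_fun X) Q"
      then show "\<exists>t\<in>uminus ` T. \<bar>- l1norm (transpose X ** Q) - t\<bar> \<le> c * (norm v)\<^sup>2"
        using limiting_subdiff_ell_fun[of v X Q] near[of _ Q v] neg by metis
    qed (use T Qs in auto)
  next
    fix Zs :: "(real^'k^'n) \<times> (real^'k^'d)" assume Zs: "Zs \<in> binmats \<times> stiefel"
    show "\<exists>\<epsilon> \<eta>. 0 < \<epsilon> \<and> \<epsilon> < 1 \<and> 0 < \<eta> \<and>
              (\<forall>Z\<in>binmats \<times> stiefel. norm (Z - Zs) \<le> \<epsilon> \<longrightarrow>
                 dist0 (limiting_subdiff (h_fun X) Z)
                   \<ge> ereal (\<eta> * sqrt \<bar>real_of_ereal (h_fun X Z) - real_of_ereal (h_fun X Zs)\<bar>))"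
    proof (rule lojasiewicz_half_if_near_finite_set[OF h_fun_feasible])
      show "continuous_on (binmats \<times> stiefel) (\<lambda>Z::(real^'k^'n) \<times> (real^'k^'d). - ((X ** fst Z) \<bullet> snd Z))"
        by (auto simp: inner_vec_def matrix_matrix_mult_def intro!: continuous_intros)
      fix Z v :: "(real^'k^'n) \<times> (real^'k^'d)"
      assume Z: "Z \<in> binmats \<times> stiefel" and v: "v \<in> limiting_subdiff (h_fun X) Z"
      have "\<exists>t\<in>T. \<bar>(X ** fst Z) \<bullet> snd Z - t\<bar> \<le> c * (norm (snd v))\<^sup>2"
        using near[OF _ _ limiting_subdiff_h_fun[OF v]] Z by (auto simp: mem_Times_iff)
      \<comment> \<open>Only the second component of the subgradient enters the estimate, and its
        norm is at most that of the pair. The absolute value guards against a negative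
        \<open>c\<close>.\<close>
      moreover have "c * (norm (snd v))\<^sup>2 \<le> \<bar>c\<bar> * (norm v)\<^sup>2"
        using norm_snd_le[of "snd v" "fst v"] by (intro mult_mono power_mono) auto
      ultimately have "\<exists>t\<in>T. \<bar>(X ** fst Z) \<bullet> snd Z - t\<bar> \<le> \<bar>c\<bar> * (norm v)\<^sup>2"
        by (meson order_trans)
      then show "\<exists>t\<in>uminus ` T. \<bar>- ((X ** fst Z) \<bullet> snd Z) - t\<bar> \<le> \<bar>c\<bar> * (norm v)\<^sup>2"
        by (rule neg)
    qed (use T Zs in auto)
  qed
qed

end
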